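(* The asymptotic growth constant for the number of dimer-monomers on the two-dimensional Sierpinski gasket, $$z_{SG_2}=\lim_{n\to\infty}\frac{\ln N_{DM}(SG_2(n))}{v(SG_2(n))},$$ is $z_{SG_2}=0.656294236916\ldots$ (i.e. its decimal expansion begins with the digits shown).
   Context: A dimer-monomer configuration on a finite graph $G$ is a placement of dimers on edges such that each vertex is covered by at most one dimer (i.e. a matching of $G$, not necessarily perfect, possibly empty). $N_{DM}(G)$ is the number of such configurations, and $v(G)$ is the number of vertices of $G$. The two-dimensional Sierpinski gasket graph $SG_2(n)$, with three distinguished "outmost" vertices, is defined recursively. $SG_2(0)$ is a triangle (three vertices, three edges), all of whose vertices are outmost, labelled $1,2,3$. $SG_2(n+1)$ is obtained from three disjoint copies of $SG_2(n)$, labelled $1,2,3$, by identifying, for each pair $l\neq m$, the outmost vertex $m$ of copy $l$ with the outmost vertex $l$ of copy $m$; the outmost vertex $l$ of $SG_2(n+1)$ is the outmost vertex $l$ of copy $l$. One has $v(SG_2(n))=\frac{3}{2}(3^n+1)$. *)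

theory Defs
  imports Complex_Main
begin

record 'v graph =
  verts :: "'v set"
  edges :: "'v set set"

definition vcount :: "('v, 'b) graph_scheme \<Rightarrow> nat" where
  "vcount G = card (verts G)"

definition dimer_monomer_configuration :: "('v, 'b) graph_scheme \<Rightarrow> 'v set set \<Rightarrow> bool" where
  "dimer_monomer_configuration G M \<longleftrightarrow>
     M \<subseteq> edges G \<and> (\<forall>x \<in> verts G. \<forall>d \<in> M. \<forall>e \<in> M. x \<in> d \<and> x \<in> e \<longrightarrow> d = e)"

definition N_DM :: "('v, 'b) graph_scheme \<Rightarrow> nat" where
  "N_DM G = card {M. dimer_monomer_configuration G M}"

datatype label = L1 | L2 | L3

text \<open>
  An address is a word of labels: the leading letters select a copy, then a copy within that copy,
  and so on, and the last letter is a corner of the initial triangle. Two addresses may denote the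
  same vertex because of the identifications, so a vertex is represented by the set of all its
  addresses, that is, by its class in the quotient of the disjoint union of the copies.
\<close>

type_synonym vertex = "label list set"

record gasket = "vertex graph" +
  outmost :: "label \<Rightarrow> vertex"

text \<open>
  The vertex of the glued graph that comes from the vertex \<open>x\<close> of copy \<open>l\<close>. If \<open>x\<close> is the outmost
  vertex \<open>m\<close> for some label \<open>m\<close> other than \<open>l\<close>, it is merged with the outmost vertex \<open>l\<close> of copy \<open>m\<close>;
  otherwise the class only contains the addresses coming from copy \<open>l\<close>.
\<close>

definition glue_vertex :: "gasket \<Rightarrow> label \<Rightarrow> vertex \<Rightarrow> vertex" where
  "glue_vertex G l x =
     (#) l ` x \<union> (\<Union>m \<in> {m. m \<noteq> l \<and> x = outmost G m}. (#) m ` outmost G l)"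

definition glue :: "gasket \<Rightarrow> gasket" where
  "glue G = \<lparr>
     verts = (\<Union>l. glue_vertex G l ` verts G),
     edges = (\<Union>l. (\<lambda>e. glue_vertex G l ` e) ` edges G),
     outmost = (\<lambda>l. glue_vertex G l (outmost G l)) \<rparr>"

definition triangle :: gasket where
  "triangle = \<lparr>
     verts = {{[l]} | l. True},
     edges = {{{[l]}, {[m]}} | l m. l \<noteq> m},
     outmost = (\<lambda>l. {[l]}) \<rparr>"

primrec SG2 :: "nat \<Rightarrow> gasket" where
  "SG2 0 = triangle"
| "SG2 (Suc n) = glue (SG2 n)"

text \<open>\<open>lim\<close> is only meaningful for a convergent sequence; existence has to be stated separately.\<close>

definition z_SG2 :: real where
  "z_SG2 = lim (\<lambda>n. ln (real (N_DM (SG2 n))) / real (vcount (SG2 n)))"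

end

theory Submission
  imports Defs "HOL-Analysis.Harmonic_Numbers"
begin

text \<open>
  Split the configurations of \<open>SG2 n\<close> by the set of covered corners. By symmetry this gives four
  counts \<open>f, g, h, t\<close>, and since a configuration of the glued graph amounts to three configurations
  no two of which cover the vertex they share, the counts at stage \<open>n + 1\<close> are cubic polynomials
  in those at stage \<open>n\<close>. If the ratios \<open>g/f\<close>, \<open>h/g\<close>, \<open>t/h\<close> lie in an interval \<open>[r, s]\<close>, then so do
  the next ones, and the next \<open>f\<close> lies between \<open>(1 + 2r)^3 f^3\<close> and \<open>(1 + 2s)^3 f^3\<close>. Hence
  \<open>ln f / 3^n\<close> converges, and already at stage 4 the interval is so short that one logarithm gives
  the limit to the required precision.
\<close>

section \<open>The three labels\<close>

lemma UNIV_label: "(UNIV :: label set) = {L1, L2, L3}"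
proof -
  have "l \<in> {L1, L2, L3}" for l by (cases l) auto
  then show ?thesis by blast
qed

lemma all_label: "(\<forall>l. P l) \<longleftrightarrow> P L1 \<and> P L2 \<and> P L3"
  by (metis label.exhaust)

subsection \<open>Gluing three copies\<close>

text \<open>The invariant carried through gluing: vertices are nonempty classes, so their addresses
  tell them apart; corners are distinct; edges have two ends.\<close>

definition wf_gasket :: "gasket \<Rightarrow> bool" where
  "wf_gasket G \<longleftrightarrow> finite (verts G) \<and> {} \<notin> verts G \<and> inj (outmost G) \<and> range (outmost G) \<subseteq> verts G
     \<and> (\<forall>e \<in> edges G. e \<subseteq> verts G \<and> card e = 2)"

lemma wf_gasketD:
  assumes "wf_gasket G"
  shows "finite (verts G)" "{} \<notin> verts G" "inj (outmost G)" "outmost G l \<in> verts G"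
    and "e \<in> edges G \<Longrightarrow> e \<subseteq> verts G" "e \<in> edges G \<Longrightarrow> card e = 2"
  using assms by (auto simp: wf_gasket_def)

text \<open>Merging only adds addresses whose first letter differs from \<open>l\<close>, so
  stripping a leading \<open>l\<close> recovers \<open>x\<close>.\<close>

lemma inj_glue_vertex: "inj (glue_vertex G l)"
proof (rule injI)
  fix x y assume eq: "glue_vertex G l x = glue_vertex G l y"
  have *: "{w. l # w \<in> glue_vertex G l x} = x" for x
    by (auto simp: glue_vertex_def)
  have "x = {w. l # w \<in> glue_vertex G l x}" by (rule *[symmetric])
  also have "\<dots> = y" unfolding eq by (rule *)
  finally show "x = y" .
qed

text \<open>Strip a leading \<open>l\<close> from both sides. A class coming from copy
  \<open>m\<close> has such addresses only if \<open>y\<close> is corner \<open>l\<close>, and they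
  then strip to corner \<open>m\<close>; nonemptiness of \<open>x\<close> rules out the other
  case.\<close>

lemma glue_vertex_eq_iff:
  assumes wf: "wf_gasket G" and x: "x \<in> verts G" and lm: "l \<noteq> m"
  shows "glue_vertex G l x = glue_vertex G m y \<longleftrightarrow> x = outmost G m \<and> y = outmost G l"
proof
  assume eq: "glue_vertex G l x = glue_vertex G m y"
  have *: "x = {w. l # w \<in> glue_vertex G l x}"
    by (auto simp: glue_vertex_def)
  have **: "{w. l # w \<in> glue_vertex G m y} = (if y = outmost G l then outmost G m else {})"
    using lm by (auto simp: glue_vertex_def)
  have "x = (if y = outmost G l then outmost G m else {})"
    using * ** unfolding eq by (rule trans)
  moreover have "x \<noteq> {}" using x wf by (auto simp: wf_gasket_def)
  ultimately show "x = outmost G m \<and> y = outmost G l" by (auto split: if_splits)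
next
  assume *: "x = outmost G m \<and> y = outmost G l"
  have inj: "outmost G a = outmost G b \<longleftrightarrow> a = b" for a b
    using wf by (auto simp: wf_gasket_def inj_eq)
  have "{k. k \<noteq> l \<and> outmost G m = outmost G k} = {m}" "{k. k \<noteq> m \<and> outmost G l = outmost G k} = {l}"
    using lm by (auto simp: inj)
  then show "glue_vertex G l x = glue_vertex G m y"
    using * by (auto simp: glue_vertex_def)
qed

lemma glue_simps:
  "verts (glue G) = (\<Union>l. glue_vertex G l ` verts G)"
  "edges (glue G) = (\<Union>l. (`) (glue_vertex G l) ` edges G)"
  "outmost (glue G) l = glue_vertex G l (outmost G l)"
  by (simp_all add: glue_def)

text \<open>Merging in copy \<open>l\<close> affects only corners with another label. Corners are
  distinct, so corner \<open>l\<close> of copy \<open>l\<close> is never merged.\<close>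

lemma glue_vertex_outmost_eq_iff:
  assumes "wf_gasket G"
  shows "glue_vertex G l (outmost G l) = glue_vertex G m y \<longleftrightarrow> l = m \<and> y = outmost G l"
proof (cases "l = m")
  case True
  then show ?thesis using inj_glue_vertex[of G m] by (auto simp: inj_eq)
next
  case False
  then have "outmost G l \<noteq> outmost G m"
    using assms by (auto simp: wf_gasket_def inj_eq)
  then show ?thesis
    using False glue_vertex_eq_iff[OF assms, of "outmost G l" l m y] wf_gasketD(4)[OF assms]
    by auto
qed

lemma wf_gasket_glue:
  assumes "wf_gasket G"
  shows "wf_gasket (glue G)"
  unfolding wf_gasket_def
proof (intro conjI ballI)
  note wf = wf_gasketD[OF assms]
  show "finite (verts (glue G))"
    using wf(1) by (auto simp: glue_simps UNIV_label)
  show "{} \<notin> verts (glue G)"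
    using wf(2) by (auto simp: glue_simps glue_vertex_def)
  show "inj (outmost (glue G))"
    by (rule injI) (simp add: glue_simps glue_vertex_outmost_eq_iff[OF assms])
  show "range (outmost (glue G)) \<subseteq> verts (glue G)"
    using wf(4) by (auto simp: glue_simps)
  fix e assume "e \<in> edges (glue G)"
  then obtain l d where d: "d \<in> edges G" "e = glue_vertex G l ` d"
    by (auto simp: glue_simps)
  show "e \<subseteq> verts (glue G)" using wf(5)[OF d(1)] d(2) by (auto simp: glue_simps)
  show "card e = 2"
    using wf(6)[OF d(1)] d(2) inj_glue_vertex[of G l] by (simp add: card_image inj_on_subset)
qed

lemma verts_triangle: "verts Defs.triangle = {{[L1]}, {[L2]}, {[L3]}}"
  using UNIV_label by (auto simp: Defs.triangle_def)

lemma wf_gasket_triangle: "wf_gasket Defs.triangle"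
  unfolding wf_gasket_def
proof (intro conjI ballI)
  show "finite (verts Defs.triangle)" by (simp add: verts_triangle)
next
  fix e assume "e \<in> edges Defs.triangle"
  then show "card e = 2" by (auto simp: Defs.triangle_def)
qed (auto simp: Defs.triangle_def inj_def)

lemma wf_gasket_SG2: "wf_gasket (SG2 n)"
  by (induction n) (auto intro: wf_gasket_triangle wf_gasket_glue)

text \<open>Inclusion-exclusion: two copies share one vertex, and the third meets their union in two
  distinct vertices. The 3 stands on the left to avoid subtraction on \<open>nat\<close>.\<close>

lemma vcount_glue:
  assumes wf: "wf_gasket G"
  shows "vcount (glue G) + 3 = 3 * vcount G"
proof -
  define V where "V l = glue_vertex G l ` verts G" for l
  have fin: "finite (V l)" for l using wf_gasketD(1)[OF wf] by (simp add: V_def)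
  have card: "card (V l) = vcount G" for l
    using inj_glue_vertex[of G l] by (simp add: V_def vcount_def card_image inj_on_subset)
  have int: "V l \<inter> V m = {glue_vertex G l (outmost G m)}" if "l \<noteq> m" for l m
  proof -
    have "glue_vertex G l (outmost G m) = glue_vertex G m (outmost G l)"
      using glue_vertex_eq_iff[OF wf, of "outmost G m" l m] that wf_gasketD(4)[OF wf] by simp
    then have "glue_vertex G l (outmost G m) \<in> V l \<inter> V m"
      using wf_gasketD(4)[OF wf] by (auto simp: V_def)
    moreover have "V l \<inter> V m \<subseteq> {glue_vertex G l (outmost G m)}"
      using glue_vertex_eq_iff[OF wf] that by (auto simp: V_def)
    ultimately show ?thesis by blast
  qed
  have "card (V L1) + card (V L2) = card (V L1 \<union> V L2) + card (V L1 \<inter> V L2)"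
    by (rule card_Un_Int) (auto simp: fin)
  moreover have "card (V L1 \<union> V L2) + card (V L3)
      = card (V L1 \<union> V L2 \<union> V L3) + card ((V L1 \<union> V L2) \<inter> V L3)"
    by (rule card_Un_Int) (auto simp: fin)
  moreover have "(V L1 \<union> V L2) \<inter> V L3 = {glue_vertex G L3 (outmost G L1), glue_vertex G L3 (outmost G L2)}"
    using int[of L3 L1] int[of L3 L2] by auto
  moreover have "glue_vertex G L3 (outmost G L1) \<noteq> glue_vertex G L3 (outmost G L2)"
    using inj_glue_vertex[of G L3] wf_gasketD(3)[OF wf] by (simp add: inj_eq)
  moreover have "verts (glue G) = V L1 \<union> V L2 \<union> V L3"
    by (auto simp: glue_simps V_def UNIV_label)
  ultimately show ?thesis
    using int[of L1 L2] by (simp add: card vcount_def)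
qed

lemma vcount_SG2: "real (vcount (SG2 n)) = 3 / 2 * (3 ^ n + 1)"
proof (induction n)
  case 0
  show ?case by (simp add: vcount_def verts_triangle)
next
  case (Suc n)
  have "real (vcount (glue (SG2 n)) + 3) = real (3 * vcount (SG2 n))"
    by (simp only: vcount_glue[OF wf_gasket_SG2])
  then show ?case using Suc by (simp add: field_simps)
qed

subsection \<open>Configurations with prescribed corners\<close>

definition covers :: "gasket \<Rightarrow> vertex set set \<Rightarrow> label \<Rightarrow> bool" where
  "covers G M l \<longleftrightarrow> outmost G l \<in> \<Union>M"

definition conf :: "gasket \<Rightarrow> bool \<Rightarrow> bool \<Rightarrow> bool \<Rightarrow> vertex set set set" where
  "conf G a b c = {M. dimer_monomer_configuration G M
     \<and> covers G M L1 = a \<and> covers G M L2 = b \<and> covers G M L3 = c}"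

text \<open>The definition tests conflicts at vertices of the graph only; edges consist of such
  vertices, so this amounts to pairwise disjointness.\<close>

lemma dmc_iff:
  assumes "wf_gasket G"
  shows "dimer_monomer_configuration G M \<longleftrightarrow>
    M \<subseteq> edges G \<and> (\<forall>d \<in> M. \<forall>e \<in> M. d \<inter> e \<noteq> {} \<longrightarrow> d = e)"
  using wf_gasketD(5)[OF assms] unfolding dimer_monomer_configuration_def by blast

lemma finite_dmc:
  assumes "wf_gasket G"
  shows "finite {M. dimer_monomer_configuration G M}"
proof (rule finite_subset)
  have "edges G \<subseteq> Pow (verts G)" using wf_gasketD(5)[OF assms] by blast
  then show "finite (Pow (edges G))"
    using wf_gasketD(1)[OF assms] finite_subset by blast
qed (auto simp: dimer_monomer_configuration_def)

lemma finite_conf: "wf_gasket G \<Longrightarrow> finite (conf G a b c)"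
  by (rule finite_subset[OF _ finite_dmc]) (auto simp: conf_def)

lemma N_DM_eq_sum:
  assumes "wf_gasket G"
  shows "N_DM G = (\<Sum>a\<in>UNIV. \<Sum>b\<in>UNIV. \<Sum>c\<in>UNIV. card (conf G a b c))"
proof -
  have "{M. dimer_monomer_configuration G M} = (\<Union>(a, b, c) \<in> UNIV. conf G a b c)"
    by (auto simp: conf_def)
  then have "N_DM G = card (\<Union>(a, b, c) \<in> UNIV. conf G a b c)"
    by (simp add: N_DM_def)
  also have "\<dots> = (\<Sum>(a, b, c) \<in> UNIV. card (conf G a b c))"
  proof (subst card_UN_disjoint)
    show "\<forall>i\<in>UNIV. finite (case i of (a, b, c) \<Rightarrow> conf G a b c)"
      using finite_conf[OF assms] by auto
    show "\<forall>i\<in>UNIV. \<forall>j\<in>UNIV. i \<noteq> j \<longrightarrow>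
        (case i of (a, b, c) \<Rightarrow> conf G a b c) \<inter> (case j of (a, b, c) \<Rightarrow> conf G a b c) = {}"
      by (auto simp: conf_def)
  qed (auto intro!: sum.cong)
  finally show ?thesis
    by (simp add: UNIV_Times_UNIV[symmetric] sum.cartesian_product del: UNIV_Times_UNIV)
qed

section \<open>Configurations of the glued graph as compatible triples\<close>

definition join :: "gasket \<Rightarrow> (label \<Rightarrow> vertex set set) \<Rightarrow> vertex set set" where
  "join G F = (\<Union>l. (`) (glue_vertex G l) ` F l)"

text \<open>Distinct copies share a single vertex while an edge has two, so no edge lies in two
  copies.\<close>

lemma image_glue_vertex_eq_iff:
  assumes wf: "wf_gasket G" and d: "d \<in> edges G"
  shows "glue_vertex G l ` d = glue_vertex G m ` e \<longleftrightarrow> l = m \<and> d = e"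
proof (cases "l = m")
  case True
  then show ?thesis using inj_glue_vertex[of G m] by (auto simp: inj_image_eq_iff)
next
  case False
  have "glue_vertex G l ` d \<noteq> glue_vertex G m ` e"
  proof
    assume eq: "glue_vertex G l ` d = glue_vertex G m ` e"
    have "d \<subseteq> {outmost G m}"
    proof
      fix x assume x: "x \<in> d"
      then obtain y where "glue_vertex G l x = glue_vertex G m y" using eq by blast
      then show "x \<in> {outmost G m}"
        using glue_vertex_eq_iff[OF wf _ False, of x y] x wf_gasketD(5)[OF wf d] by auto
    qed
    then have "card d \<le> card {outmost G m}" by (rule card_mono[rotated]) simp
    then show False using wf_gasketD(6)[OF wf d] by simp
  qed
  then show ?thesis using False by simp
qed

text \<open>By the previous lemma, \<open>F l\<close> is recovered as the set of edges whose image
  from copy \<open>l\<close> lies in the join.\<close>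

lemma join_inj:
  assumes wf: "wf_gasket G" and F: "\<And>l. F l \<subseteq> edges G" and F': "\<And>l. F' l \<subseteq> edges G"
    and eq: "join G F = join G F'"
  shows "F = F'"
proof -
  have *: "F l = {e \<in> edges G. glue_vertex G l ` e \<in> join G F}" if "\<forall>k. F k \<subseteq> edges G" for F l
  proof -
    have "glue_vertex G l ` e \<in> join G F \<longleftrightarrow> e \<in> F l" if "e \<in> edges G" for e
      using image_glue_vertex_eq_iff[OF wf that] by (simp add: join_def image_iff)
    then show ?thesis using that by blast
  qed
  show ?thesis
  proof
    fix l
    have "F l = {e \<in> edges G. glue_vertex G l ` e \<in> join G F}" by (rule *) (use F in blast)
    also have "\<dots> = F' l" unfolding eq by (rule *[symmetric]) (use F' in blast)
    finally show "F l = F' l" .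
  qed
qed

lemma covers_join:
  assumes wf: "wf_gasket G"
  shows "covers (glue G) (join G F) l \<longleftrightarrow> covers G (F l) l"
proof -
  have "covers (glue G) (join G F) l \<longleftrightarrow>
      (\<exists>m. \<exists>e \<in> F m. \<exists>y \<in> e. glue_vertex G l (outmost G l) = glue_vertex G m y)"
    by (simp add: covers_def glue_simps join_def image_iff)
  then show ?thesis
    by (simp add: glue_vertex_outmost_eq_iff[OF wf] covers_def)
qed

text \<open>Edges from different copies can meet only at the vertex the copies share, so the only
  new conflict is that both copies cover it.\<close>

lemma dmc_join_iff:
  assumes wf: "wf_gasket G"
  shows "dimer_monomer_configuration (glue G) (join G F) \<and> (\<forall>l. F l \<subseteq> edges G) \<longleftrightarrow>
    (\<forall>l. dimer_monomer_configuration G (F l)) \<and>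
    (\<forall>l m. l \<noteq> m \<longrightarrow> \<not> (covers G (F l) m \<and> covers G (F m) l))" (is "?L \<longleftrightarrow> ?R")
proof
  assume L: ?L
  then have sub: "F l \<subseteq> edges G" for l by blast
  have disj: "d' = e'" if "d' \<in> join G F" "e' \<in> join G F" "d' \<inter> e' \<noteq> {}" for d' e'
    using L[THEN conjunct1, unfolded dmc_iff[OF wf_gasket_glue[OF wf]]] that by blast
  have disj': "l = m \<and> d = e" if "d \<in> F l" "e \<in> F m" "glue_vertex G l ` d \<inter> glue_vertex G m ` e \<noteq> {}" for d e l m
  proof -
    have "glue_vertex G l ` d = glue_vertex G m ` e"
      by (rule disj) (use that in \<open>unfold join_def, blast+\<close>)
    then show ?thesis using image_glue_vertex_eq_iff[OF wf, of d l m e] sub[of l] that(1) by blast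
  qed
  show ?R
  proof (intro conjI allI impI)
    fix l
    have "d = e" if "d \<in> F l" "e \<in> F l" "d \<inter> e \<noteq> {}" for d e
      using disj'[of d l e l] that by blast
    then show "dimer_monomer_configuration G (F l)" using sub unfolding dmc_iff[OF wf] by blast
  next
    fix l m :: label assume lm: "l \<noteq> m"
    have eq: "glue_vertex G l (outmost G m) = glue_vertex G m (outmost G l)"
      using glue_vertex_eq_iff[OF wf _ lm] wf_gasketD(4)[OF wf] by simp
    show "\<not> (covers G (F l) m \<and> covers G (F m) l)"
    proof
      assume "covers G (F l) m \<and> covers G (F m) l"
      then obtain d e where "d \<in> F l" "outmost G m \<in> d" "e \<in> F m" "outmost G l \<in> e"
        unfolding covers_def by blast
      \<comment> \<open>The edges covering the shared vertex from the two sides intersect after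
        gluing, which would put them in the same copy.\<close>
      then have "l = m \<and> d = e" using disj'[of d l e m] eq by blast
      then show False using lm by simp
    qed
  qed
next
  assume R: ?R
  then have sub: "F l \<subseteq> edges G" for l unfolding dmc_iff[OF wf] by blast
  have "d' = e'" if de: "d' \<in> join G F" "e' \<in> join G F" "d' \<inter> e' \<noteq> {}" for d' e'
  proof -
    obtain l d m e where d: "d' = glue_vertex G l ` d" "d \<in> F l" and e: "e' = glue_vertex G m ` e" "e \<in> F m"
      using de(1,2) unfolding join_def by blast
    obtain x y where xy: "x \<in> d" "y \<in> e" "glue_vertex G l x = glue_vertex G m y"
      using de(3) d(1) e(1) by blast
    show ?thesis
    proof (cases "l = m")
      case True
      then have "x = y" using xy inj_glue_vertex[of G m] by (auto simp: inj_eq)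
      moreover have "\<forall>d \<in> F l. \<forall>e \<in> F l. d \<inter> e \<noteq> {} \<longrightarrow> d = e"
        using R unfolding dmc_iff[OF wf] by blast
      ultimately have "d = e" using d(2) e(2) xy(1,2) True by blast
      then show ?thesis using d e True by simp
    next
      case False
      have "x \<in> verts G" using sub wf_gasketD(5)[OF wf] d(2) xy(1) by blast
      then have "x = outmost G m \<and> y = outmost G l"
        using glue_vertex_eq_iff[OF wf _ False] xy(3) by blast
      then have "covers G (F l) m \<and> covers G (F m) l"
        using xy(1,2) d(2) e(2) unfolding covers_def by blast
      then show ?thesis using R False by blast
    qed
  qed
  moreover have "join G F \<subseteq> edges (glue G)" using sub unfolding join_def glue_simps by blast
  ultimately show ?L unfolding dmc_iff[OF wf_gasket_glue[OF wf]] using sub by blast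
qed

text \<open>The admissible states of a shared vertex: covered from neither side, from the first
  copy, or from the second.\<close>

definition free_pairs :: "(bool \<times> bool) set" where
  "free_pairs = {(False, False), (True, False), (False, True)}"

lemma mem_free_pairs: "(x, y) \<in> free_pairs \<longleftrightarrow> \<not> (x \<and> y)"
  by (auto simp: free_pairs_def)

text \<open>The bit \<open>xlm\<close> tells whether copy \<open>l\<close> covers its corner
  \<open>m\<close>, so each pair is the state of one shared vertex. Corner \<open>l\<close> of copy
  \<open>l\<close> stays a corner and carries the prescribed bit.\<close>

lemma conf_glue_bij:
  assumes wf: "wf_gasket G"
  shows "bij_betw (\<lambda>(A, B, C). join G (\<lambda>l. case l of L1 \<Rightarrow> A | L2 \<Rightarrow> B | L3 \<Rightarrow> C))
    (\<Union>((x12, x21), (x13, x31), (x23, x32)) \<in> free_pairs \<times> free_pairs \<times> free_pairs.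
      conf G a x12 x13 \<times> conf G x21 b x23 \<times> conf G x31 x32 c)
    (conf (glue G) a b c)"
    (is "bij_betw ?j ?U _")
proof -
  let ?F = "\<lambda>A B C l. case l of L1 \<Rightarrow> A | L2 \<Rightarrow> B | L3 \<Rightarrow> C"
  have U: "(A, B, C) \<in> ?U \<longleftrightarrow>
      (\<forall>l. dimer_monomer_configuration G (?F A B C l)) \<and>
      (\<forall>l m. l \<noteq> m \<longrightarrow> \<not> (covers G (?F A B C l) m \<and> covers G (?F A B C m) l)) \<and>
      covers G A L1 = a \<and> covers G B L2 = b \<and> covers G C L3 = c" (is "_ \<longleftrightarrow> ?R A B C") for A B C
  proof -
    have "(A, B, C) \<in> ?U \<longleftrightarrow> (covers G A L2, covers G B L1) \<in> free_pairs \<and>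
        (covers G A L3, covers G C L1) \<in> free_pairs \<and> (covers G B L3, covers G C L2) \<in> free_pairs \<and>
        dimer_monomer_configuration G A \<and> dimer_monomer_configuration G B \<and>
        dimer_monomer_configuration G C \<and> covers G A L1 = a \<and> covers G B L2 = b \<and> covers G C L3 = c"
      by (simp add: conf_def Bex_def split_paired_Ex) blast
    also have "\<dots> \<longleftrightarrow> ?R A B C"
      by (simp add: all_label mem_free_pairs) blast
    finally show ?thesis .
  qed
  have sub: "?F A B C l \<subseteq> edges G" if "(A, B, C) \<in> ?U" for A B C l
    using that dmc_iff[OF wf] unfolding U by blast
  have "inj_on ?j ?U"
  proof (rule inj_onI)
    fix p q
    assume *: "p \<in> ?U" "q \<in> ?U" "?j p = ?j q"
    obtain A B C A' B' C' where pq: "p = (A, B, C)" "q = (A', B', C')" by (metis prod_cases3)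
    have "?F A B C = ?F A' B' C'"
    proof (rule join_inj[OF wf])
      show "?F A B C l \<subseteq> edges G" "?F A' B' C' l \<subseteq> edges G" for l
        using * sub unfolding pq by blast+
      show "join G (?F A B C) = join G (?F A' B' C')"
        using *(3) by (simp only: pq prod.case)
    qed
    then have "?F A B C l = ?F A' B' C' l" for l by (rule fun_cong)
    from this[of L1] this[of L2] this[of L3] show "p = q" by (simp add: pq)
  qed
  moreover have "?j ` ?U = conf (glue G) a b c"
  proof (intro equalityI subsetI)
    fix M assume "M \<in> ?j ` ?U"
    then obtain A B C where *: "(A, B, C) \<in> ?U" "M = join G (?F A B C)" by fast
    then show "M \<in> conf (glue G) a b c"
      using dmc_join_iff[OF wf, of "?F A B C"] covers_join[OF wf, of "?F A B C"]
      unfolding U by (auto simp: conf_def)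
  next
    fix M assume M: "M \<in> conf (glue G) a b c"
    \<comment> \<open>The inverse of \<open>join\<close>: pull \<open>M\<close> back to each
      copy.\<close>
    define F where "F l = {e \<in> edges G. glue_vertex G l ` e \<in> M}" for l
    have "M \<subseteq> edges (glue G)" using M by (auto simp: conf_def dimer_monomer_configuration_def)
    then have MF: "M = join G F" by (fastforce simp: F_def join_def glue_simps)
    have FF: "F = ?F (F L1) (F L2) (F L3)" by (rule ext) (simp split: label.split)
    have "(\<forall>l. dimer_monomer_configuration G (F l)) \<and>
      (\<forall>l m. l \<noteq> m \<longrightarrow> \<not> (covers G (F l) m \<and> covers G (F m) l))"
      using M dmc_join_iff[OF wf, of F] unfolding MF by (auto simp: F_def conf_def)
    moreover have "covers G (F L1) L1 = a" "covers G (F L2) L2 = b" "covers G (F L3) L3 = c"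
      using M covers_join[OF wf, of F] unfolding MF by (auto simp: conf_def)
    ultimately have "(F L1, F L2, F L3) \<in> ?U" unfolding U FF[symmetric] by blast
    moreover have "M = ?j (F L1, F L2, F L3)" using MF FF by simp
    ultimately show "M \<in> ?j ` ?U" by blast
  qed
  ultimately show ?thesis by (simp add: bij_betw_def)
qed

text \<open>The bits are determined by the triple of configurations, so the products in the union
  are disjoint and their cardinalities add up.\<close>

lemma card_conf_glue:
  assumes wf: "wf_gasket G"
  shows "card (conf (glue G) a b c) =
    (\<Sum>(x12, x21) \<in> free_pairs. \<Sum>(x13, x31) \<in> free_pairs. \<Sum>(x23, x32) \<in> free_pairs.
      card (conf G a x12 x13) * card (conf G x21 b x23) * card (conf G x31 x32 c))"
proof -
  let ?P = "\<lambda>((x12, x21), (x13, x31), (x23, x32)).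
      conf G a x12 x13 \<times> conf G x21 b x23 \<times> conf G x31 x32 c"
  have fin: "finite free_pairs" by (simp add: free_pairs_def)
  have "card (conf (glue G) a b c) = card (\<Union>p \<in> free_pairs \<times> free_pairs \<times> free_pairs. ?P p)"
    using bij_betw_same_card[OF conf_glue_bij[OF wf]] by metis
  also have "\<dots> = (\<Sum>p \<in> free_pairs \<times> free_pairs \<times> free_pairs. card (?P p))"
  proof (rule card_UN_disjoint)
    show "\<forall>i\<in>free_pairs \<times> free_pairs \<times> free_pairs. finite (?P i)"
      using finite_conf[OF wf] by auto
    show "\<forall>i\<in>free_pairs \<times> free_pairs \<times> free_pairs. \<forall>j\<in>free_pairs \<times> free_pairs \<times> free_pairs.
        i \<noteq> j \<longrightarrow> ?P i \<inter> ?P j = {}"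
      by (auto simp: conf_def)
  qed (simp add: fin)
  finally show ?thesis
    by (simp add: sum.cartesian_product card_cartesian_product split_def mult.assoc)
qed

subsection \<open>The recurrence for the counts\<close>

text \<open>
  \<open>f\<close>, \<open>g\<close>, \<open>h\<close>, \<open>t\<close> count the configurations that cover none of the corners, a given one,
  a given two, and all three.
\<close>

definition step0 :: "'a::comm_semiring_1 \<Rightarrow> 'a \<Rightarrow> 'a \<Rightarrow> 'a \<Rightarrow> 'a" where
  "step0 f g h t = f*f*f + 6*f*f*g + 9*f*g*g + 3*f*f*h + 6*f*g*h + 2*g*g*g"

definition step1 :: "'a::comm_semiring_1 \<Rightarrow> 'a \<Rightarrow> 'a \<Rightarrow> 'a \<Rightarrow> 'a" where
  "step1 f g h t = f*f*g + 4*f*g*g + 2*f*f*h + 8*f*g*h + 3*g*g*g + f*f*t + 2*f*g*t + 4*g*g*h + 2*f*h*h"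

definition step2 :: "'a::comm_semiring_1 \<Rightarrow> 'a \<Rightarrow> 'a \<Rightarrow> 'a \<Rightarrow> 'a" where
  "step2 f g h t = f*g*g + 4*f*g*h + 2*g*g*g + 3*f*h*h + 7*g*g*h + 2*f*g*t + 2*f*h*t + 2*g*g*t + 4*g*h*h"

definition step3 :: "'a::comm_semiring_1 \<Rightarrow> 'a \<Rightarrow> 'a \<Rightarrow> 'a \<Rightarrow> 'a" where
  "step3 f g h t = g*g*g + 6*g*g*h + 9*g*h*h + 3*g*g*t + 6*g*h*t + 2*h*h*h"

text \<open>The index of a polynomial is the number of covered corners after gluing. Each polynomial
  collects the 27 products given by the states of the three shared vertices;
  \<open>sum_free_pairs_weight\<close> checks this.\<close>

definition step :: "nat \<times> nat \<times> nat \<times> nat \<Rightarrow> nat \<times> nat \<times> nat \<times> nat" where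
  "step = (\<lambda>(f, g, h, t). (step0 f g h t, step1 f g h t, step2 f g h t, step3 f g h t))"

text \<open>In the triangle the empty configuration covers no corner, and a single edge covers a
  given two; one or three covered corners are impossible.\<close>

definition counts :: "nat \<Rightarrow> nat \<times> nat \<times> nat \<times> nat" where
  "counts n = (step ^^ n) (1, 0, 1, 0)"

lemma counts_Suc: "counts (Suc n) = step (counts n)"
  by (simp add: counts_def)

text \<open>
  Each monomial of \<open>step1\<close> arises from one of \<open>step0\<close> by replacing a factor \<open>f\<close>, \<open>g\<close> or \<open>h\<close> by
  its successor \<open>g\<close>, \<open>h\<close> or \<open>t\<close>, and likewise for the next two pairs; the coefficients below
  record such a pairing.
\<close>

lemma step_diff:
  fixes f g h t r :: "'a::comm_ring_1"
  shows "step1 f g h t - r * step0 f g h t =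
      (g - r*f) * (f*f + 4*f*g + 3*g*g + 2*f*h + 2*g*h)
      + (h - r*g) * (2*f*f + 6*f*g + 2*f*h + 2*g*g) + (t - r*h) * (f*f + 2*f*g)"
    and "step2 f g h t - r * step1 f g h t =
      (g - r*f) * (f*g + 2*f*h + 2*g*g + f*t + 4*g*h + 2*h*h)
      + (h - r*g) * (2*f*g + 3*g*g + 3*f*h + 2*f*t + 2*g*h) + (t - r*h) * (f*g + 2*g*g)"
    and "step3 f g h t - r * step2 f g h t =
      (g - r*f) * (g*g + 4*g*h + 3*h*h + 2*g*t + 2*h*t)
      + (h - r*g) * (2*g*g + 6*g*h + 2*g*t + 2*h*h) + (t - r*h) * (g*g + 2*g*h)"
  unfolding step0_def step1_def step2_def step3_def by (simp_all add: algebra_simps)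

section \<open>Intervals preserved by the ratios of consecutive counts\<close>

definition ratios_ge :: "real \<Rightarrow> nat \<times> nat \<times> nat \<times> nat \<Rightarrow> bool" where
  "ratios_ge r = (\<lambda>(f, g, h, t). r * f \<le> g \<and> r * g \<le> h \<and> r * h \<le> t)"

definition ratios_le :: "real \<Rightarrow> nat \<times> nat \<times> nat \<times> nat \<Rightarrow> bool" where
  "ratios_le s = (\<lambda>(f, g, h, t). g \<le> s * f \<and> h \<le> s * g \<and> t \<le> s * h)"

lemma of_nat_step:
  "of_nat (step0 f g h t) = step0 (of_nat f) (of_nat g) (of_nat h) (of_nat t)"
  "of_nat (step1 f g h t) = step1 (of_nat f) (of_nat g) (of_nat h) (of_nat t)"
  "of_nat (step2 f g h t) = step2 (of_nat f) (of_nat g) (of_nat h) (of_nat t)"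
  "of_nat (step3 f g h t) = step3 (of_nat f) (of_nat g) (of_nat h) (of_nat t)"
  by (simp_all add: step0_def step1_def step2_def step3_def)

text \<open>By \<open>step_diff\<close> each new difference is a combination of the old ones with
  nonnegative coefficients.\<close>

lemma ratios_ge_step:
  assumes "ratios_ge r w"
  shows "ratios_ge r (step w)"
proof -
  obtain f g h t where w: "w = (f, g, h, t)" by (metis prod_cases4)
  have "0 \<le> real g - r * f" "0 \<le> real h - r * g" "0 \<le> real t - r * h"
    using assms by (simp_all add: ratios_ge_def w)
  then have "0 \<le> real (step1 f g h t) - r * real (step0 f g h t)"
    "0 \<le> real (step2 f g h t) - r * real (step1 f g h t)"
    "0 \<le> real (step3 f g h t) - r * real (step2 f g h t)"
    unfolding of_nat_step step_diff
    by (intro add_nonneg_nonneg mult_nonneg_nonneg; simp)+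
  then show ?thesis by (simp add: ratios_ge_def step_def w)
qed

lemma ratios_le_step:
  assumes "ratios_le s w"
  shows "ratios_le s (step w)"
proof -
  obtain f g h t where w: "w = (f, g, h, t)" by (metis prod_cases4)
  have "real g - s * f \<le> 0" "real h - s * g \<le> 0" "real t - s * h \<le> 0"
    using assms by (simp_all add: ratios_le_def w)
  then have "real (step1 f g h t) - s * real (step0 f g h t) \<le> 0"
    "real (step2 f g h t) - s * real (step1 f g h t) \<le> 0"
    "real (step3 f g h t) - s * real (step2 f g h t) \<le> 0"
    unfolding of_nat_step step_diff
    by (intro add_nonpos_nonpos mult_nonpos_nonneg; simp)+
  then show ?thesis by (simp add: ratios_le_def step_def w)
qed

text \<open>On a geometric progression the monomials collect to coefficients 1, 6, 12, 8, a perfect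
  cube.\<close>

lemma step0_geometric: "step0 f (r*f) (r*(r*f)) t = (1 + 2 * r)^3 * f^3" for f r :: "'a::comm_ring_1"
  by (simp add: step0_def algebra_simps power3_eq_cube)

lemma step0_mono:
  fixes f g h t g' h' t' :: real
  assumes "0 \<le> f" "0 \<le> g" "0 \<le> h" "g \<le> g'" "h \<le> h'"
  shows "step0 f g h t \<le> step0 f g' h' t'"
  unfolding step0_def using assms by (intro add_mono mult_mono mult_nonneg_nonneg order_refl; simp)

text \<open>Here \<open>g\<close> and \<open>h\<close> dominate the geometric progression with first
  term \<open>f\<close> and ratio \<open>r\<close>, and \<open>step0\<close> is monotone in
  both.\<close>

lemma step0_ge:
  assumes "0 \<le> r" "ratios_ge r (f, g, h, t)"
  shows "(1 + 2 * r)^3 * real f^3 \<le> real (step0 f g h t)"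
proof -
  have g: "r * f \<le> g" and h: "r * g \<le> h" using assms by (auto simp: ratios_ge_def)
  have "r * (r * f) \<le> h" using mult_left_mono[OF g assms(1)] h by linarith
  then show ?thesis
    using step0_mono[of "real f" "r * f" "r * (r * f)" "real g" "real h" t t] g assms(1)
    unfolding of_nat_step step0_geometric by simp
qed

lemma step0_le:
  assumes "0 \<le> s" "ratios_le s (f, g, h, t)"
  shows "real (step0 f g h t) \<le> (1 + 2 * s)^3 * real f^3"
proof -
  have g: "g \<le> s * f" and h: "h \<le> s * g" using assms by (auto simp: ratios_le_def)
  have "h \<le> s * (s * f)" using mult_left_mono[OF g assms(1)] h by linarith
  then show ?thesis
    using step0_mono[of "real f" "real g" "real h" "s * f" "s * (s * f)" t t] g assms(1)
    unfolding of_nat_step step0_geometric by simp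
qed

section \<open>Exact counts up to stage 4 and the resulting interval\<close>

lemma counts_1: "counts 1 = (4, 4, 3, 2)"
  by (simp add: counts_def step_def step0_def step1_def step2_def step3_def)

lemma counts_4:
  "counts 4 = (9618673427679675357952788786053120, 8183299472241085511976093040508928,
    6962123286110084944276569997705216, 5923180596700062197918947839311872)"
proof -
  note step_defs = step_def step0_def step1_def step2_def step3_def
  have c2: "counts 2 = (1584, 1352, 1148, 970)"
    using counts_Suc[of 1] by (simp add: counts_1 step_defs numeral_2_eq_2[symmetric] del: One_nat_def)
  have "counts 3 = (78721368064, 66974056448, 56979607552, 48476491776)"
    using counts_Suc[of 2] by (simp add: c2 step_defs)
  then show ?thesis
    using counts_Suc[of 3] by (simp add: step_defs)
qed

definition fcount :: "nat \<Rightarrow> real" where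
  "fcount n = real (fst (counts n))"

text \<open>Outward roundings of the ratios \<open>g/f\<close>, \<open>h/g\<close> and \<open>t/h\<close> at stage 4.\<close>

definition r4 :: real where "r4 = 85077215 / 10^8"
definition s4 :: real where "s4 = 850772150003 / 10^12"

lemma ratios_counts:
  assumes "n \<ge> 4"
  shows "ratios_ge r4 (counts n) \<and> ratios_le s4 (counts n)"
  using assms
proof (induction n rule: dec_induct)
  case base
  show ?case by (simp add: counts_4 ratios_ge_def ratios_le_def r4_def s4_def)
next
  case (step n)
  then show ?case by (simp add: counts_Suc ratios_ge_step ratios_le_step)
qed

lemma fcount_Suc_bounds:
  assumes "n \<ge> 4"
  shows "(1 + 2 * r4)^3 * fcount n ^ 3 \<le> fcount (Suc n)"
    and "fcount (Suc n) \<le> (1 + 2 * s4)^3 * fcount n ^ 3"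
proof -
  obtain f g h t where w: "counts n = (f, g, h, t)" by (metis prod_cases4)
  have f: "fcount n = real f" "fcount (Suc n) = real (step0 f g h t)"
    by (simp_all add: fcount_def counts_Suc step_def w)
  show "(1 + 2 * r4)^3 * fcount n ^ 3 \<le> fcount (Suc n)"
    unfolding f by (rule step0_ge) (use ratios_counts[OF assms] in \<open>simp_all add: r4_def w\<close>)
  show "fcount (Suc n) \<le> (1 + 2 * s4)^3 * fcount n ^ 3"
    unfolding f by (rule step0_le) (use ratios_counts[OF assms] in \<open>simp_all add: s4_def w\<close>)
qed

lemma fcount_4: "fcount 4 = 9618673427679675357952788786053120"
  by (simp add: fcount_def counts_4)

lemma fcount_pos: "n \<ge> 4 \<Longrightarrow> fcount n > 0"
proof (induction n rule: dec_induct)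
  case base
  then show ?case by (simp add: fcount_4)
next
  case (step n)
  have "0 < (1 + 2 * r4)^3 * fcount n ^ 3" using step by (simp add: r4_def)
  also have "\<dots> \<le> fcount (Suc n)" using step by (intro fcount_Suc_bounds)
  finally show ?case .
qed

subsection \<open>Limits of almost tripling sequences\<close>

lemma div_power3_tendsto_0: "(\<lambda>n. x / 3^n) \<longlonglongrightarrow> (0::real)"
proof -
  have "(\<lambda>n. x * (1/3)^n) \<longlonglongrightarrow> x * 0"
    by (intro tendsto_mult tendsto_const LIMSEQ_realpow_zero) simp_all
  then show ?thesis by (simp add: power_one_over)
qed

text \<open>
  \<open>(u n + c/2) / 3^n\<close> increases and \<open>(u n + d/2) / 3^n\<close> decreases.
\<close>

lemma triple_recurrence_limit:
  fixes u :: "nat \<Rightarrow> real"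
  assumes lo: "\<And>n. n \<ge> k \<Longrightarrow> 3 * u n + c \<le> u (Suc n)"
    and hi: "\<And>n. n \<ge> k \<Longrightarrow> u (Suc n) \<le> 3 * u n + d"
  obtains L where "(\<lambda>n. u n / 3^n) \<longlonglongrightarrow> L"
    and "(u k + c/2) / 3^k \<le> L" and "L \<le> (u k + d/2) / 3^k"
proof -
  define p where "p n = (u (n + k) + c/2) / 3^(n + k)" for n
  define q where "q n = (u (n + k) + d/2) / 3^(n + k)" for n
  have z: "(\<lambda>n. x / 3^(n + k)) \<longlonglongrightarrow> 0" for x :: real
    by (rule LIMSEQ_ignore_initial_segment[OF div_power3_tendsto_0])
  have "incseq p"
  proof (rule incseq_SucI)
    fix n
    \<comment> \<open>The shift \<open>c/2\<close> is chosen so that 3 (u + c/2) = (3 u + c) +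
      c/2.\<close>
    have "p n = (3 * u (n + k) + 3 * c/2) / 3^(Suc n + k)"
      by (simp add: p_def field_simps)
    also have "\<dots> \<le> p (Suc n)"
      unfolding p_def by (rule divide_right_mono) (use lo[of "n + k"] in simp_all)
    finally show "p n \<le> p (Suc n)" .
  qed
  have "decseq q"
  proof (rule decseq_SucI)
    fix n
    have "q (Suc n) \<le> (3 * u (n + k) + 3 * d/2) / 3^(Suc n + k)"
      unfolding q_def by (rule divide_right_mono) (use hi[of "n + k"] in simp_all)
    also have "\<dots> = q n" by (simp add: q_def field_simps)
    finally show "q (Suc n) \<le> q n" .
  qed
  \<comment> \<open>Both recurrence bounds apply at \<open>k\<close>, which orders the constants and
    keeps \<open>p\<close> below \<open>q\<close>.\<close>
  have cd: "c \<le> d" using lo[of k] hi[of k] by simp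
  have pq: "p n \<le> q n" for n using cd by (simp add: p_def q_def divide_right_mono)
  have "p n \<le> q 0" for n using pq[of n] decseqD[OF \<open>decseq q\<close>, of 0 n] by simp
  then obtain L where L: "p \<longlonglongrightarrow> L" "\<And>n. p n \<le> L"
    using incseq_convergent[OF \<open>incseq p\<close>] by metis
  have "(\<lambda>n. p n - (c/2) / 3^(n + k)) \<longlonglongrightarrow> L - 0"
    by (intro tendsto_diff L z)
  then have u: "(\<lambda>n. u (n + k) / 3^(n + k)) \<longlonglongrightarrow> L"
    by (simp add: p_def add_divide_distrib)
  have "L \<le> q 0"
  proof (rule LIMSEQ_le_const2[OF L(1)])
    show "\<exists>N. \<forall>n\<ge>N. p n \<le> q 0" using \<open>\<And>n. p n \<le> q 0\<close> by blast
  qed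
  show thesis
    by (rule that[OF LIMSEQ_offset[OF u]]) (use L(2)[of 0] \<open>L \<le> q 0\<close> in \<open>simp_all add: p_def q_def\<close>)
qed

subsection \<open>Growth of the configurations without covered corners\<close>

text \<open>Logarithms turn the cubic bounds into an additive recurrence with constants 3 ln (1 +
  2r). Since 162 = 2 * 3^4, each bound at stage 4 becomes a single logarithm.\<close>

lemma ln_fcount_limit:
  obtains L where "(\<lambda>n. ln (fcount n) / 3^n) \<longlonglongrightarrow> L"
    and "ln (fcount 4 ^ 2 * (1 + 2 * r4)^3) / 162 \<le> L"
    and "L \<le> ln (fcount 4 ^ 2 * (1 + 2 * s4)^3) / 162"
proof -
  have pos: "1 + 2 * r4 > 0" "1 + 2 * s4 > 0" by (simp_all add: r4_def s4_def)
  have ln3: "ln (x^3 * y^3) = 3 * ln y + 3 * ln x" if "x > 0" "y > 0" for x y :: real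
    using that by (simp add: ln_mult ln_realpow)
  have ln2: "ln (y^2 * x^3) / 162 = (ln y + 3 * ln x / 2) / 3^4" if "x > 0" "y > 0" for x y :: real
    using that by (simp add: ln_mult ln_realpow field_simps)
  have lo: "3 * ln (fcount n) + 3 * ln (1 + 2 * r4) \<le> ln (fcount (Suc n))" if "n \<ge> 4" for n
    unfolding ln3[OF pos(1) fcount_pos[OF that], symmetric]
    using fcount_Suc_bounds(1)[OF that] fcount_pos[OF that] fcount_pos[of "Suc n"] pos that
    by (subst ln_le_cancel_iff) simp_all
  have hi: "ln (fcount (Suc n)) \<le> 3 * ln (fcount n) + 3 * ln (1 + 2 * s4)" if "n \<ge> 4" for n
    unfolding ln3[OF pos(2) fcount_pos[OF that], symmetric]
    using fcount_Suc_bounds(2)[OF that] fcount_pos[OF that] fcount_pos[of "Suc n"] pos that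
    by (subst ln_le_cancel_iff) simp_all
  obtain L where "(\<lambda>n. ln (fcount n) / 3^n) \<longlonglongrightarrow> L"
    "(ln (fcount 4) + 3 * ln (1 + 2 * r4) / 2) / 3^4 \<le> L"
    "L \<le> (ln (fcount 4) + 3 * ln (1 + 2 * s4) / 2) / 3^4"
    using triple_recurrence_limit[of 4 "\<lambda>n. ln (fcount n)", OF lo hi] by blast
  then show thesis
    using that ln2[OF pos(1) fcount_pos[of 4]] ln2[OF pos(2) fcount_pos[of 4]] by simp
qed

subsection \<open>The counts of the gasket\<close>

text \<open>Expresses the symmetry of the gasket: only the number of covered corners matters. No
  automorphisms are used; the symmetry comes out of the induction in
  \<open>card_conf_SG2\<close>.\<close>

definition weight :: "nat \<times> nat \<times> nat \<times> nat \<Rightarrow> bool \<Rightarrow> bool \<Rightarrow> bool \<Rightarrow> nat" where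
  "weight = (\<lambda>(f, g, h, t) a b c. [f, g, h, t] ! (of_bool a + of_bool b + of_bool c))"

lemma weight_simps:
  "weight (f, g, h, t) a b c =
    (if a then if b then if c then t else h else if c then h else g
     else if b then if c then h else g else if c then g else f)"
  by (simp add: weight_def numeral_2_eq_2 numeral_3_eq_3)

lemma subset_three_unique:
  assumes "M \<subseteq> {p, q, r}" and "\<And>d e. d \<in> M \<Longrightarrow> e \<in> M \<Longrightarrow> d = e"
  shows "M \<in> {{}, {p}, {q}, {r}}"
proof (cases "M = {}")
  case False
  then obtain d where "d \<in> M" by blast
  then have "M = {d}" using assms(2) by blast
  then show ?thesis using assms(1) by simp
qed simp

text \<open>Any two edges of the triangle share a corner, so a configuration has at most one edge,
  which covers exactly its two ends.\<close>

lemma conf_triangle: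
  "conf (SG2 0) a b c = {M. (M = {} \<and> \<not> a \<and> \<not> b \<and> \<not> c)
    \<or> (M = {{{[L1]}, {[L2]}}} \<and> a \<and> b \<and> \<not> c)
    \<or> (M = {{{[L1]}, {[L3]}}} \<and> a \<and> \<not> b \<and> c)
    \<or> (M = {{{[L2]}, {[L3]}}} \<and> \<not> a \<and> b \<and> c)}"
proof -
  let ?p = "{{[L1]}, {[L2]}}" and ?q = "{{[L1]}, {[L3]}}" and ?r = "{{[L2]}, {[L3]}}"
  have edges: "edges (SG2 0) = {?p, ?q, ?r}"
  proof (intro equalityI subsetI)
    fix e assume "e \<in> edges (SG2 0)"
    then obtain l m where "l \<noteq> m" "e = {{[l]}, {[m]}}" by (auto simp: Defs.triangle_def)
    then show "e \<in> {?p, ?q, ?r}" by (cases l; cases m) (simp_all add: insert_commute)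
  next
    fix e assume "e \<in> {?p, ?q, ?r}"
    then show "e \<in> edges (SG2 0)" by (auto simp: Defs.triangle_def)
  qed
  have "dimer_monomer_configuration (SG2 0) M \<longleftrightarrow> M \<in> {{}, {?p}, {?q}, {?r}}" for M
  proof
    assume *: "dimer_monomer_configuration (SG2 0) M"
    then have sub: "M \<subseteq> {?p, ?q, ?r}"
      and inter: "\<forall>d \<in> M. \<forall>e \<in> M. d \<inter> e \<noteq> {} \<longrightarrow> d = e"
      unfolding dmc_iff[OF wf_gasket_SG2] edges by blast+
    have "d = e" if "d \<in> M" "e \<in> M" for d e
    proof -
      have "d \<in> {?p, ?q, ?r}" "e \<in> {?p, ?q, ?r}" using sub that by blast+
      then have "d \<inter> e \<noteq> {}" by (elim insertE emptyE) simp_all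
      then show ?thesis using inter that by blast
    qed
    then show "M \<in> {{}, {?p}, {?q}, {?r}}"
      by (rule subset_three_unique[OF sub])
  next
    assume "M \<in> {{}, {?p}, {?q}, {?r}}"
    then show "dimer_monomer_configuration (SG2 0) M"
      unfolding dmc_iff[OF wf_gasket_SG2] edges by (elim insertE emptyE) simp_all
  qed
  then have "conf (SG2 0) a b c = {M. M \<in> {{}, {?p}, {?q}, {?r}}
      \<and> covers (SG2 0) M L1 = a \<and> covers (SG2 0) M L2 = b \<and> covers (SG2 0) M L3 = c}"
    by (simp add: conf_def)
  also have "\<dots> = {M. (M = {} \<and> \<not> a \<and> \<not> b \<and> \<not> c)
    \<or> (M = {?p} \<and> a \<and> b \<and> \<not> c) \<or> (M = {?q} \<and> a \<and> \<not> b \<and> c)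
    \<or> (M = {?r} \<and> \<not> a \<and> b \<and> c)}"
    by (intro Collect_cong)
      (simp add: conj_disj_distribR covers_def Defs.triangle_def cong: conj_cong)
  finally show ?thesis .
qed

lemma sum_free_pairs: "(\<Sum>(x, y) \<in> free_pairs. F x y) = F False False + F True False + F False True"
  for F :: "bool \<Rightarrow> bool \<Rightarrow> nat"
  by (simp add: free_pairs_def)

text \<open>A polynomial identity for each of the eight corner patterns.\<close>

lemma sum_free_pairs_weight:
  "(\<Sum>(x12, x21) \<in> free_pairs. \<Sum>(x13, x31) \<in> free_pairs. \<Sum>(x23, x32) \<in> free_pairs.
      weight (f, g, h, t) a x12 x13 * weight (f, g, h, t) x21 b x23 * weight (f, g, h, t) x31 x32 c)
    = weight (step0 f g h t, step1 f g h t, step2 f g h t, step3 f g h t) a b c"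
  unfolding sum_free_pairs weight_simps step0_def step1_def step2_def step3_def
  by (cases a; cases b; cases c; simp only: if_True if_False simp_thms; algebra)

lemma card_conf_SG2: "card (conf (SG2 n) a b c) = weight (counts n) a b c"
proof (induction n arbitrary: a b c)
  case 0
  show ?case
    unfolding conf_triangle
    by (cases a; cases b; cases c) (simp_all add: counts_def weight_simps)
next
  case (Suc n)
  obtain f g h t where w: "counts n = (f, g, h, t)" by (metis prod_cases4)
  show ?case
    unfolding SG2.simps card_conf_glue[OF wf_gasket_SG2] Suc w counts_Suc step_def prod.case
    by (rule sum_free_pairs_weight)
qed

lemma N_DM_SG2:
  assumes "counts n = (f, g, h, t)"
  shows "N_DM (SG2 n) = f + 3 * g + 3 * h + t"
  unfolding N_DM_eq_sum[OF wf_gasket_SG2] card_conf_SG2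
  by (simp add: UNIV_bool assms weight_simps)

subsection \<open>The growth constant\<close>

text \<open>As \<open>s4\<close> is below 1, the counts decrease from \<open>f\<close> to
  \<open>t\<close>, and the total f + 3g + 3h + t has eight summands.\<close>

lemma N_DM_SG2_bounds:
  assumes "n \<ge> 4"
  shows "fcount n \<le> real (N_DM (SG2 n))" "real (N_DM (SG2 n)) \<le> 8 * fcount n"
proof -
  obtain f g h t where w: "counts n = (f, g, h, t)" by (metis prod_cases4)
  have "real g \<le> s4 * f" "real h \<le> s4 * g" "real t \<le> s4 * h"
    using ratios_counts[OF assms] by (auto simp: w ratios_le_def)
  moreover have "s4 * x \<le> x" if "x \<ge> 0" for x :: real
    using that by (simp add: s4_def)
  ultimately have "real g \<le> f" "real h \<le> g" "real t \<le> h"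
    by (meson of_nat_0_le_iff order_trans)+
  then show "fcount n \<le> real (N_DM (SG2 n))" "real (N_DM (SG2 n)) \<le> 8 * fcount n"
    by (simp_all add: N_DM_SG2[OF w] fcount_def w)
qed

text \<open>The factor 8 between the total and \<open>fcount\<close> contributes only ln 8 / 3^n,
  which vanishes.\<close>

lemma growth_limit:
  assumes L: "(\<lambda>n. ln (fcount n) / 3^n) \<longlonglongrightarrow> L"
  shows "(\<lambda>n. ln (real (N_DM (SG2 n))) / real (vcount (SG2 n))) \<longlonglongrightarrow> 2/3 * L"
proof -
  let ?N = "\<lambda>n. ln (real (N_DM (SG2 n))) / 3^n"
  have "?N \<longlonglongrightarrow> L"
  proof (rule tendsto_sandwich[OF _ _ L])
    show "\<forall>\<^sub>F n in sequentially. ln (fcount n) / 3^n \<le> ?N n"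
      using eventually_ge_at_top[of 4]
    proof eventually_elim
      case (elim n)
      then have "ln (fcount n) \<le> ln (real (N_DM (SG2 n)))"
        using fcount_pos[OF elim] N_DM_SG2_bounds(1)[OF elim] by simp
      then show ?case by (simp add: divide_right_mono)
    qed
    show "\<forall>\<^sub>F n in sequentially. ?N n \<le> ln (fcount n) / 3^n + ln 8 / 3^n"
      using eventually_ge_at_top[of 4]
    proof eventually_elim
      case (elim n)
      have "ln (real (N_DM (SG2 n))) \<le> ln (8 * fcount n)"
        using fcount_pos[OF elim] N_DM_SG2_bounds[OF elim] by simp
      also have "\<dots> = ln (fcount n) + ln 8"
        using fcount_pos[OF elim] by (simp add: ln_mult)
      finally show ?case by (simp add: divide_right_mono flip: add_divide_distrib)
    qed
    show "(\<lambda>n. ln (fcount n) / 3^n + ln 8 / 3^n) \<longlonglongrightarrow> L"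
      using tendsto_add[OF L div_power3_tendsto_0[of "ln 8"]] by simp
  qed
  \<comment> \<open>The second factor is \<open>3^n\<close> divided by the number of
    vertices.\<close>
  then have "(\<lambda>n. ?N n * (2 / 3 / (1 + 1 / 3^n))) \<longlonglongrightarrow> L * (2 / 3 / (1 + 0))"
    by (intro tendsto_intros div_power3_tendsto_0) simp_all
  moreover have "?N n * (2 / 3 / (1 + 1 / 3^n)) = ln (real (N_DM (SG2 n))) / real (vcount (SG2 n))" for n
    unfolding vcount_SG2 by (simp add: divide_simps) (simp add: algebra_simps)?
  ultimately show ?thesis by (simp add: mult.commute)
qed

subsection \<open>Numerical bounds\<close>

text \<open>Thirteen digits are taken because ln 2 enters the final estimate with the factor
  230.\<close>

lemma ln_2_bounds: "0.6931471805599 \<le> ln (2::real)" "ln (2::real) \<le> 0.69314718056"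
  using ln_approx_bounds[of 2 13] by (simp_all add: eval_nat_numeral)

text \<open>Three terms of ln x = 2 artanh y; the tail is bounded by a geometric series. For the
  arguments used below, y is about 0.028 and this tail bound is under 10^-11.\<close>

lemma ln_bounds_3:
  fixes x y :: real
  assumes "x > 1" and y: "y = (x - 1) / (x + 1)"
  shows "2*y + 2*y^3/3 + 2*y^5/5 \<le> ln x"
    and "ln x \<le> 2*y + 2*y^3/3 + 2*y^5/5 + 2 * (y^7 / (1 - y^2) / 7)"
proof -
  have s: "{..<3::nat} = {0, 1, 2}" by auto
  show "2*y + 2*y^3/3 + 2*y^5/5 \<le> ln x"
     "ln x \<le> 2*y + 2*y^3/3 + 2*y^5/5 + 2 * (y^7 / (1 - y^2) / 7)"
    using ln_approx_bounds[OF assms(1), of 3] unfolding y[symmetric] s by (simp_all add: eval_nat_numeral)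
qed

lemma ln_lower: "0.05564804188 \<le> ln (1.0572255191522::real)"
  by (rule order_trans[OF _ ln_bounds_3(1)[OF _ refl]]) (simp_all add: power_divide)

lemma ln_upper: "ln (1.0572255191594::real) \<le> 0.0556480418973"
  by (rule order_trans[OF ln_bounds_3(2)[OF _ refl]]) (simp_all add: power_divide)

theorem mainTheorem2:
  shows "(\<lambda>n. ln (real (N_DM (SG2 n))) / real (vcount (SG2 n))) \<longlonglongrightarrow> z_SG2
    \<and> 0.656294236916 \<le> z_SG2 \<and> z_SG2 < 0.656294236917"
proof -
  obtain L where L: "(\<lambda>n. ln (fcount n) / 3^n) \<longlonglongrightarrow> L"
    and lo: "ln (fcount 4 ^ 2 * (1 + 2 * r4)^3) / 162 \<le> L"
    and hi: "L \<le> ln (fcount 4 ^ 2 * (1 + 2 * s4)^3) / 162"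
    by (rule ln_fcount_limit)
  have lim: "(\<lambda>n. ln (real (N_DM (SG2 n))) / real (vcount (SG2 n))) \<longlonglongrightarrow> 2/3 * L"
    by (rule growth_limit[OF L])
  then have z: "z_SG2 = 2/3 * L" unfolding z_SG2_def by (rule limI)

  define X where "X = fcount 4 ^ 2 * (1 + 2 * r4)^3"
  define Y where "Y = fcount 4 ^ 2 * (1 + 2 * s4)^3"
  \<comment> \<open>Splitting off a power of two leaves an argument close to 1, where three series
    terms suffice. With the factor 2/3, the bounds on the limit become (230 ln 2 + ln x) /
    243.\<close>
  have ln_scale: "ln (2^k * x) = k * ln 2 + ln x" if "x > 0" for x :: real and k :: nat
    using that by (simp add: ln_mult ln_realpow)

  text \<open>The two decimals are \<open>X / 2^230\<close> and \<open>Y / 2^230\<close>, rounded outwards.\<close>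
  have "ln (2^230 * 1.0572255191522) \<le> ln X"
    by (subst ln_le_cancel_iff) (simp_all add: X_def fcount_4 r4_def power_divide)
  then have "230 * ln 2 + ln 1.0572255191522 \<le> ln X"
    by (subst (asm) ln_scale) simp_all
  then have "0.656294236916 \<le> 2/3 * L"
    using lo[folded X_def] ln_2_bounds(1) ln_lower by simp
  moreover have "ln Y \<le> ln (2^230 * 1.0572255191594)"
    by (subst ln_le_cancel_iff) (simp_all add: Y_def fcount_4 s4_def power_divide)
  then have "ln Y \<le> 230 * ln 2 + ln 1.0572255191594"
    by (subst (asm) ln_scale) simp_all
  then have "2/3 * L < 0.656294236917"
    using hi[folded Y_def] ln_2_bounds(2) ln_upper by simp
  ultimately show ?thesis using lim unfolding z by blast
qed

end
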